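(* Let $\mathbf V^{(n+1)}=(V_1^{(n+1)},\dots,V_{n_e}^{(n+1)})\in(S_h^k)^{n_e}$, $n=0,\dots,n_i-1$, be the solution of the backward Euler system $$\left(\frac{V_i^{(n+1)}-V_i^{(n)}}{\delta},W_i\right)+b_2^{(n+1)}a_i^{(n+1)}\left(\frac{\partial V_i^{(n+1)}}{\partial y},\frac{\partial W_i}{\partial y}\right)-\left(b_1^{(n+1)}\frac{\partial V_i^{(n+1)}}{\partial y},W_i\right)=(g_i^{(n+1)},W_i)$$ for all $W_i\in S_h^k$, $i=1,\dots,n_e$, where $a_i^{(n+1)}=a_i\big(l^{(n+1)}(V_1^{(n+1)}),\dots,l^{(n+1)}(V_{n_e}^{(n+1)})\big)$ and $V_i^{(0)}=I_hv_{i0}$. If $$\delta<\frac{\gamma_0}{\gamma_0+\gamma'_{\max}},$$ then $$\left\|V_i^{(n+1)}\right\|^2\le C^{n+1}\left\|V_i^{(0)}\right\|^2+\sum_{l=0}^{n+1}C^{\,n-l+2}\,\delta\left\|g_i^{(l)}\right\|^2,$$ where the constant $C$ could depend on $\gamma'_{\max}$, $\gamma_0$ and $\delta$.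
   Context: Let $n_e\ge1$ be an integer and $T>0$. Let $\alpha,\beta\in\mathcal C^2([0,T])$ with $\alpha',\beta'\in L_2(]0,T[)$, put $\gamma=\beta-\alpha$, and assume $0<\gamma_0<\gamma(t)<\gamma_1<\infty$, $|\gamma'(t)|\le\gamma'_{\max}$ and $|\alpha'(t)|\le\alpha'_{\max}$ for all $t\in[0,T]$. Put $\Omega_t=]\alpha(t),\beta(t)[$ and $\Omega=]0,1[$. For $i=1,\dots,n_e$: $u_{i0}\in H_0^1(\Omega_0)$; $f_i$ satisfies $\int_0^T\int_{\Omega_t}f_i^2\,dx\,dt<\infty$; $a_i:\mathbb R^{n_e}\to\mathbb R^+$ is Lipschitz-continuous with $0<m_a\le a_i(s)\le M_a$ for all $s\in\mathbb R^{n_e}$. Notation: $b_1(y,t)=\dfrac{\alpha'(t)+\gamma'(t)y}{\gamma(t)}$, $b_2(t)=\dfrac1{\gamma(t)^2}$, $g_i(y,t)=f_i(\alpha(t)+\gamma(t)y,t)$, $v_{i0}(y)=u_{i0}(\alpha(0)+\gamma(0)y)$. Time is discretised with step $\delta>0$, $t_n=n\delta$, $n=0,\dots,n_i$, $T=n_i\delta$; a superscript $(n)$ on a given function denotes its value at $t_n$, so $b_1^{(n)}=b_1(\cdot,t_n)$, $b_2^{(n)}=b_2(t_n)$, $g_i^{(n)}=g_i(\cdot,t_n)$ (assumed to be in $L_2(\Omega)$), and $l^{(n)}(w)=\gamma(t_n)\int_0^1w(y)\,dy$. $\|\cdot\|$ and $(\cdot,\cdot)$ are the norm and inner product of $L_2(\Omega)$.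 $\mathcal T_h$ is a partition of $\Omega$ into disjoint intervals of maximal length $h$; $S_h^k$ ($k\ge1$ an integer) is the space of continuous functions on $[0,1]$ that vanish at $0$ and $1$ and are polynomials of degree $k$ on each interval of $\mathcal T_h$; $I_h$ is the Lagrange interpolation operator onto $S_h^k$. *)

theory Defs
  imports "HOL-Analysis.Analysis"
begin

text \<open>The space \<open>L\<^sub>2(S)\<close> for \<open>S \<subseteq> \<real>\<close>, with its inner product and norm.  The latter two are
  meaningful for functions satisfying \<open>in_L2\<close> only.\<close>

definition in_L2 :: "real set \<Rightarrow> (real \<Rightarrow> real) \<Rightarrow> bool" where
  "in_L2 S u \<longleftrightarrow>
     set_borel_measurable lebesgue S u \<and> set_integrable lebesgue S (\<lambda>x. (u x)\<^sup>2)"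

definition inner_L2 :: "real set \<Rightarrow> (real \<Rightarrow> real) \<Rightarrow> (real \<Rightarrow> real) \<Rightarrow> real" where
  "inner_L2 S u v = (LINT x:S|lebesgue. u x * v x)"

definition norm_L2 :: "real set \<Rightarrow> (real \<Rightarrow> real) \<Rightarrow> real" where
  "norm_L2 S u = sqrt (inner_L2 S u u)"

text \<open>Derivative relative to a set, one-sided at the end points of a compact interval.\<close>

definition deriv_within :: "real set \<Rightarrow> (real \<Rightarrow> real) \<Rightarrow> real \<Rightarrow> real" where
  "deriv_within S u t = vector_derivative u (at t within S)"

definition C2_on :: "real set \<Rightarrow> (real \<Rightarrow> real) \<Rightarrow> bool" where
  "C2_on S u \<longleftrightarrow>
     u differentiable_on S \<and>
     deriv_within S u differentiable_on S \<and>
     continuous_on S (deriv_within S (deriv_within S u))"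

text \<open>Smooth functions with compact support in the open interval \<open>]a, b[\<close>, and the Sobolev
  spaces \<open>H\<^sup>1(]a, b[)\<close> and \<open>H\<^sub>0\<^sup>1(]a, b[)\<close>, the latter as the closure of the former functions.\<close>

definition test_functions :: "real \<Rightarrow> real \<Rightarrow> (real \<Rightarrow> real) set" where
  "test_functions a b =
     {\<phi>. (\<forall>n x. (deriv ^^ n) \<phi> differentiable (at x)) \<and>
         (\<exists>c d. a < c \<and> c \<le> d \<and> d < b \<and> (\<forall>x. x \<notin> {c..d} \<longrightarrow> \<phi> x = 0))}"

definition weak_derivative :: "real \<Rightarrow> real \<Rightarrow> (real \<Rightarrow> real) \<Rightarrow> (real \<Rightarrow> real) \<Rightarrow> bool" where
  "weak_derivative a b u w \<longleftrightarrow>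
     (\<forall>\<phi>\<in>test_functions a b. inner_L2 {a<..<b} u (deriv \<phi>) = - inner_L2 {a<..<b} w \<phi>)"

definition in_H10 :: "real \<Rightarrow> real \<Rightarrow> (real \<Rightarrow> real) \<Rightarrow> bool" where
  "in_H10 a b u \<longleftrightarrow>
     in_L2 {a<..<b} u \<and>
     (\<exists>w. in_L2 {a<..<b} w \<and> weak_derivative a b u w \<and>
       (\<exists>\<phi>. (\<forall>m::nat. \<phi> m \<in> test_functions a b) \<and>
          (\<lambda>m. norm_L2 {a<..<b} (\<lambda>x. \<phi> m x - u x)) \<longlonglongrightarrow> 0 \<and>
          (\<lambda>m. norm_L2 {a<..<b} (\<lambda>x. deriv (\<phi> m) x - w x)) \<longlonglongrightarrow> 0))"

text \<open>\<open>\<real>\<^bsup>n\<^esup>\<close> is represented by the functions in \<open>{1..n} \<rightarrow>\<^sub>E UNIV\<close>, so that constants can be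
  chosen independently of \<open>n\<close>.\<close>

definition lipschitz_on_Rn :: "nat \<Rightarrow> ((nat \<Rightarrow> real) \<Rightarrow> real) \<Rightarrow> bool" where
  "lipschitz_on_Rn n F \<longleftrightarrow>
     (\<exists>L. \<forall>s \<in> {1..n} \<rightarrow>\<^sub>E UNIV. \<forall>s' \<in> {1..n} \<rightarrow>\<^sub>E UNIV.
        \<bar>F s - F s'\<bar> \<le> L * L2_set (\<lambda>j. s j - s' j) {1..n})"

text \<open>The data on the moving domain \<open>]\<alpha>(t), \<beta>(t)[\<close>.  An element of \<open>H\<^sub>0\<^sup>1\<close> is
  identified with its continuous representative, since \<open>u0 i\<close> is later evaluated at points.\<close>

definition admissible_data ::
  "nat \<Rightarrow> real \<Rightarrow> (real \<Rightarrow> real) \<Rightarrow> (real \<Rightarrow> real) \<Rightarrow> real \<Rightarrow> real \<Rightarrow> real \<Rightarrow> real \<Rightarrow>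
   (nat \<Rightarrow> real \<Rightarrow> real) \<Rightarrow> (nat \<Rightarrow> real \<Rightarrow> real \<Rightarrow> real) \<Rightarrow>
   (nat \<Rightarrow> (nat \<Rightarrow> real) \<Rightarrow> real) \<Rightarrow> real \<Rightarrow> real \<Rightarrow> bool" where
  "admissible_data ne T \<alpha> \<beta> \<gamma>0 \<gamma>1 \<gamma>'max \<alpha>'max u0 f a ma Ma \<longleftrightarrow>
     1 \<le> ne \<and> 0 < T \<and>
     C2_on {0..T} \<alpha> \<and> C2_on {0..T} \<beta> \<and>
     in_L2 {0<..<T} (deriv_within {0..T} \<alpha>) \<and>
     in_L2 {0<..<T} (deriv_within {0..T} \<beta>) \<and>
     0 < \<gamma>0 \<and>
     (\<forall>t\<in>{0..T}. \<gamma>0 < \<beta> t - \<alpha> t \<and> \<beta> t - \<alpha> t < \<gamma>1) \<and>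
     (\<forall>t\<in>{0..T}. \<bar>deriv_within {0..T} (\<lambda>\<tau>. \<beta> \<tau> - \<alpha> \<tau>) t\<bar> \<le> \<gamma>'max) \<and>
     (\<forall>t\<in>{0..T}. \<bar>deriv_within {0..T} \<alpha> t\<bar> \<le> \<alpha>'max) \<and>
     0 < ma \<and>
     (\<forall>i\<in>{1..ne}.
        in_H10 (\<alpha> 0) (\<beta> 0) (u0 i) \<and> continuous_on {\<alpha> 0..\<beta> 0} (u0 i) \<and>
        set_borel_measurable lebesgue {(x, t). 0 < t \<and> t < T \<and> \<alpha> t < x \<and> x < \<beta> t}
          (\<lambda>(x, t). f i x t) \<and>
        (\<integral>\<^sup>+t\<in>{0<..<T}. (\<integral>\<^sup>+x\<in>{\<alpha> t<..<\<beta> t}. ennreal ((f i x t)\<^sup>2) \<partial>lebesgue) \<partial>lebesgue) < \<infinity> \<and>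
        lipschitz_on_Rn ne (a i) \<and>
        (\<forall>s \<in> {1..ne} \<rightarrow>\<^sub>E UNIV. ma \<le> a i s \<and> a i s \<le> Ma))"

text \<open>Coefficients and data transported to the fixed domain \<open>]0, 1[\<close>; \<open>T\<close> only enters
  through the one-sided derivatives at the ends of \<open>[0, T]\<close>.\<close>

definition coeff_b1 ::
  "real \<Rightarrow> (real \<Rightarrow> real) \<Rightarrow> (real \<Rightarrow> real) \<Rightarrow> real \<Rightarrow> real \<Rightarrow> real" where
  "coeff_b1 T \<alpha> \<beta> y t =
     (deriv_within {0..T} \<alpha> t + deriv_within {0..T} (\<lambda>\<tau>. \<beta> \<tau> - \<alpha> \<tau>) t * y) / (\<beta> t - \<alpha> t)"

definition coeff_b2 :: "(real \<Rightarrow> real) \<Rightarrow> (real \<Rightarrow> real) \<Rightarrow> real \<Rightarrow> real" where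
  "coeff_b2 \<alpha> \<beta> t = 1 / (\<beta> t - \<alpha> t)\<^sup>2"

definition ref_source ::
  "(real \<Rightarrow> real) \<Rightarrow> (real \<Rightarrow> real) \<Rightarrow> (real \<Rightarrow> real \<Rightarrow> real) \<Rightarrow> real \<Rightarrow> real \<Rightarrow> real" where
  "ref_source \<alpha> \<beta> F y t = F (\<alpha> t + (\<beta> t - \<alpha> t) * y) t"

definition ref_initial ::
  "(real \<Rightarrow> real) \<Rightarrow> (real \<Rightarrow> real) \<Rightarrow> (real \<Rightarrow> real) \<Rightarrow> real \<Rightarrow> real" where
  "ref_initial \<alpha> \<beta> u y = u (\<alpha> 0 + (\<beta> 0 - \<alpha> 0) * y)"

definition nonlocal_term ::
  "(real \<Rightarrow> real) \<Rightarrow> (real \<Rightarrow> real) \<Rightarrow> real \<Rightarrow> (real \<Rightarrow> real) \<Rightarrow> real" where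
  "nonlocal_term \<alpha> \<beta> t w = (\<beta> t - \<alpha> t) * (LINT y:{0<..<1}|lebesgue. w y)"

text \<open>A partition of \<open>]0, 1[\<close> into the intervals between consecutive points
  \<open>x 0 < \<dots> < x N\<close>, the longest of which has length \<open>h\<close>.\<close>

definition is_mesh :: "(nat \<Rightarrow> real) \<Rightarrow> nat \<Rightarrow> real \<Rightarrow> bool" where
  "is_mesh x N h \<longleftrightarrow>
     1 \<le> N \<and> x 0 = 0 \<and> x N = 1 \<and> (\<forall>j<N. x j < x (Suc j)) \<and>
     h = Max ((\<lambda>j. x (Suc j) - x j) ` {..<N})"

text \<open>Elements of \<open>S\<^sub>h\<^sup>k\<close> are functions on \<open>[0, 1]\<close>: their values elsewhere are irrelevant.\<close>

definition fe_space :: "(nat \<Rightarrow> real) \<Rightarrow> nat \<Rightarrow> nat \<Rightarrow> (real \<Rightarrow> real) set" where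
  "fe_space x N k =
     {W. continuous_on {0..1} W \<and> W 0 = 0 \<and> W 1 = 0 \<and>
         (\<forall>j<N. \<exists>p :: real poly. degree p \<le> k \<and> (\<forall>y\<in>{x j..x (Suc j)}. W y = poly p y))}"

text \<open>\<open>W = I\<^sub>h v\<close>, with \<open>k + 1\<close> equally spaced interpolation nodes on each interval.  These
  conditions determine \<open>W\<close> on \<open>[0, 1]\<close>.\<close>

definition is_lagrange_interpolant ::
  "(nat \<Rightarrow> real) \<Rightarrow> nat \<Rightarrow> nat \<Rightarrow> (real \<Rightarrow> real) \<Rightarrow> (real \<Rightarrow> real) \<Rightarrow> bool" where
  "is_lagrange_interpolant x N k v W \<longleftrightarrow>
     W \<in> fe_space x N k \<and>
     (\<forall>j<N. \<forall>m\<le>k. let z = x j + real m / real k * (x (Suc j) - x j) in W z = v z)"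

text \<open>\<open>V n i\<close> is the \<open>i\<close>-th component at time \<open>n * \<delta>\<close>.  A member of \<open>fe_space\<close> is differentiable
  at all but finitely many points of \<open>]0, 1[\<close>, so \<open>deriv\<close> gives its weak derivative.\<close>

definition backward_euler_solution ::
  "nat \<Rightarrow> nat \<Rightarrow> real \<Rightarrow> real \<Rightarrow> (real \<Rightarrow> real) \<Rightarrow> (real \<Rightarrow> real) \<Rightarrow>
   (nat \<Rightarrow> real \<Rightarrow> real) \<Rightarrow> (nat \<Rightarrow> real \<Rightarrow> real \<Rightarrow> real) \<Rightarrow>
   (nat \<Rightarrow> (nat \<Rightarrow> real) \<Rightarrow> real) \<Rightarrow> (nat \<Rightarrow> real) \<Rightarrow> nat \<Rightarrow> nat \<Rightarrow>
   (nat \<Rightarrow> nat \<Rightarrow> real \<Rightarrow> real) \<Rightarrow> bool" where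
  "backward_euler_solution ne ni T \<delta> \<alpha> \<beta> u0 f a x N k V \<longleftrightarrow>
     (\<forall>i\<in>{1..ne}. is_lagrange_interpolant x N k (ref_initial \<alpha> \<beta> (u0 i)) (V 0 i)) \<and>
     (\<forall>n<ni. \<forall>i\<in>{1..ne}. V (Suc n) i \<in> fe_space x N k) \<and>
     (\<forall>n<ni. \<forall>i\<in>{1..ne}. \<forall>W\<in>fe_space x N k.
        let \<Omega> = {0<..<1}; t = real (Suc n) * \<delta> in
          inner_L2 \<Omega> (\<lambda>y. (V (Suc n) i y - V n i y) / \<delta>) W
          + coeff_b2 \<alpha> \<beta> t * a i (\<lambda>j\<in>{1..ne}. nonlocal_term \<alpha> \<beta> t (V (Suc n) j))
              * inner_L2 \<Omega> (deriv (V (Suc n) i)) (deriv W)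
          - inner_L2 \<Omega> (\<lambda>y. coeff_b1 T \<alpha> \<beta> y t * deriv (V (Suc n) i) y) W
          = inner_L2 \<Omega> (\<lambda>y. ref_source \<alpha> \<beta> (f i) y t) W)"

end

theory Submission
  imports Defs
begin

text \<open>Let \<open>v\<close> and \<open>w\<close> be the new and the old iterate.  Testing with \<open>v\<close>, the diffusion term is
  non-negative and the convection term \<open>(b\<^sub>1 v', v)\<close> is \<open>- \<gamma>' / (2 \<gamma>) * \<parallel>v\<parallel>\<^sup>2\<close> after integration by
  parts, because \<open>b\<^sub>1\<close> is affine in \<open>y\<close> with slope \<open>\<gamma>' / \<gamma>\<close> and \<open>v\<close> vanishes at both ends.
  Young's inequality leaves \<open>(1 + \<delta> \<gamma>' / \<gamma> - \<delta>) \<parallel>v\<parallel>\<^sup>2 \<le> \<parallel>w\<parallel>\<^sup>2 + \<delta> \<parallel>g\<parallel>\<^sup>2\<close>, whose factor is at least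
  \<open>1 - \<delta> (1 + \<gamma>'max / \<gamma>0) > 0\<close>.\<close>

section \<open>Integrals over a mesh and over open intervals\<close>

text \<open>The cell integrals telescope. Absolute integrability is carried along because it
  identifies the gauge integral with the Lebesgue integral in \<open>inner_L2\<close>.\<close>

lemma piecewise_has_integral:
  fixes x :: "nat \<Rightarrow> real" and f F :: "real \<Rightarrow> real"
  assumes le: "\<And>j. j < N \<Longrightarrow> x j \<le> x (Suc j)"
    and abs: "\<And>j. j < N \<Longrightarrow> f absolutely_integrable_on {x j..x (Suc j)}"
    and int: "\<And>j. j < N \<Longrightarrow> (f has_integral F (x (Suc j)) - F (x j)) {x j..x (Suc j)}"
  shows "f absolutely_integrable_on {x 0..x N} \<and> (f has_integral F (x N) - F (x 0)) {x 0..x N}"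
proof -
  have "x 0 \<le> x n \<and> f absolutely_integrable_on {x 0..x n}
      \<and> (f has_integral F (x n) - F (x 0)) {x 0..x n}" if "n \<le> N" for n
    using that
  proof (induction n)
    case 0
    have "f absolutely_integrable_on cbox (x 0) (x 0)"
      by (rule absolutely_integrable_on_null) simp
    then show ?case
      using has_integral_refl(2)[of f "x 0"] by simp
  next
    case (Suc n)
    then have IH: "x 0 \<le> x n" "f absolutely_integrable_on {x 0..x n}"
        "(f has_integral F (x n) - F (x 0)) {x 0..x n}" and n: "n < N"
      by auto
    have un: "{x 0..x n} \<union> {x n..x (Suc n)} = {x 0..x (Suc n)}"
      using IH(1) le[OF n] by (rule ivl_disj_un_two_touch)
    have "f absolutely_integrable_on {x 0..x (Suc n)}"
      using set_integrable_Un[OF IH(2) abs[OF n]] un by simp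
    moreover have "(f has_integral F (x (Suc n)) - F (x 0)) {x 0..x (Suc n)}"
      using has_integral_combine[OF IH(1) le[OF n] IH(3) int[OF n]] by (simp add: algebra_simps)
    ultimately show ?case using IH(1) le[OF n] by simp
  qed
  then show ?thesis by simp
qed

lemma LINT_Ioo_eq_has_integral:
  fixes f :: "real \<Rightarrow> real"
  assumes "f absolutely_integrable_on {a..b}" and "(f has_integral I) {a..b}"
  shows "f absolutely_integrable_on {a<..<b}" and "(LINT y:{a<..<b}|lebesgue. f y) = I"
proof -
  show i: "f absolutely_integrable_on {a<..<b}"
    using assms(1) by (rule set_integrable_subset) auto
  have "(f has_integral I) {a<..<b}"
    using assms(2) by (simp add: has_integral_Icc_iff_Ioo)
  then show "(LINT y:{a<..<b}|lebesgue. f y) = I"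
    using set_lebesgue_integral_eq_integral(2)[OF i] by (simp add: integral_unique)
qed

lemma absolutely_integrable_on_Ioo_if_continuous:
  fixes f :: "real \<Rightarrow> real"
  assumes "continuous_on {a..b} f"
  shows "f absolutely_integrable_on {a<..<b}"
  by (rule set_integrable_subset[OF absolutely_integrable_continuous_real[OF assms]]) auto

section \<open>Estimates for the inner product\<close>

lemma inner_L2_self_nonneg: "0 \<le> inner_L2 S u u"
  unfolding inner_L2_def set_lebesgue_integral_def
  by (rule Bochner_Integration.integral_nonneg) (auto simp: indicator_def)

lemma norm_L2_power2: "(norm_L2 S u)\<^sup>2 = inner_L2 S u u"
  unfolding norm_L2_def by (simp add: inner_L2_self_nonneg)

text \<open>Young's inequality. Integrability of the squares gives no measurability of
  \<open>u\<close> and \<open>v\<close> themselves, so the product may fail to be integrable; hence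
  the case distinction.\<close>

lemma inner_L2_le_half_norms:
  assumes "set_integrable lebesgue S (\<lambda>y. (u y)\<^sup>2)" and "set_integrable lebesgue S (\<lambda>y. (v y)\<^sup>2)"
  shows "inner_L2 S u v \<le> ((norm_L2 S u)\<^sup>2 + (norm_L2 S v)\<^sup>2) / 2"
proof (cases "set_integrable lebesgue S (\<lambda>y. u y * v y)")
  case True
  have "inner_L2 S u v \<le> (LINT y:S|lebesgue. ((u y)\<^sup>2 + (v y)\<^sup>2) / 2)"
    unfolding inner_L2_def
    by (rule set_integral_mono[OF True])
       (use assms sum_squares_bound[of "u _" "v _"] in
         \<open>auto intro!: set_integral_add simp: field_simps\<close>)
  also have "\<dots> = ((norm_L2 S u)\<^sup>2 + (norm_L2 S v)\<^sup>2) / 2"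
    unfolding norm_L2_power2 inner_L2_def power2_eq_square[symmetric]
    using set_integral_add(2)[OF assms] by simp
  finally show ?thesis .
next
  \<comment> \<open>The Bochner integral of a non-integrable function is 0 by default, and the bound
    is non-negative.\<close>
  case False
  then have "inner_L2 S u v = 0"
    unfolding inner_L2_def set_lebesgue_integral_def set_integrable_def
    by (rule not_integrable_integral_eq)
  then show ?thesis by simp
qed

section \<open>Finite element functions and the terms of the tested scheme\<close>

lemma fe_space_continuous_on: "W \<in> fe_space x N k \<Longrightarrow> continuous_on {0..1} W"
  by (simp add: fe_space_def)

text \<open>Each point of an open cell has a neighbourhood on which \<open>W\<close> is a
  polynomial. At a node the one-sided derivatives may differ, so \<open>deriv W\<close> is described
  on the open cell only.\<close>

lemma fe_space_deriv_eq_poly: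
  assumes "W \<in> fe_space x N k" and "j < N"
  obtains p where "\<And>y. y \<in> {x j..x (Suc j)} \<Longrightarrow> W y = poly p y"
    and "\<And>y. y \<in> {x j<..<x (Suc j)} \<Longrightarrow> deriv W y = poly (pderiv p) y"
proof -
  obtain p where p: "\<And>y. y \<in> {x j..x (Suc j)} \<Longrightarrow> W y = poly p y"
    using assms unfolding fe_space_def by blast
  have "deriv W y = poly (pderiv p) y" if y: "y \<in> {x j<..<x (Suc j)}" for y
  proof (rule DERIV_imp_deriv)
    show "(W has_field_derivative poly (pderiv p) y) (at y)"
      by (rule has_field_derivative_transform_within_open[OF poly_DERIV open_greaterThanLessThan y])
         (simp add: p)
  qed
  with p show ?thesis by (rule that)
qed

text \<open>Inside each cell \<open>f\<close> is the derivative of \<open>F\<close>, so its integral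
  telescopes to \<open>F 1 - F 0\<close>; subtracting the integral of the square term in
  \<open>f\<close> leaves the convection term.\<close>

lemma fe_space_convection_identity:
  fixes A B :: real
  assumes mesh: "is_mesh x N h" and W: "W \<in> fe_space x N k"
  shows "inner_L2 {0<..<1} (\<lambda>y. (A + B * y) * deriv W y) W = - B / 2 * (norm_L2 {0<..<1} W)\<^sup>2"
proof -
  define F where "F = (\<lambda>y. (A + B * y) * (W y)\<^sup>2 / 2)"
  define f where "f = (\<lambda>y. (A + B * y) * deriv W y * W y + B / 2 * (W y)\<^sup>2)"
  have lt: "x j < x (Suc j)" if "j < N" for j
    using mesh that by (simp add: is_mesh_def)
  have "f absolutely_integrable_on {x 0..x N} \<and> (f has_integral F (x N) - F (x 0)) {x 0..x N}"
  proof (rule piecewise_has_integral)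
    fix j assume j: "j < N"
    show "x j \<le> x (Suc j)" using lt[OF j] by simp
    obtain p where p: "\<And>y. y \<in> {x j..x (Suc j)} \<Longrightarrow> W y = poly p y"
      and p': "\<And>y. y \<in> {x j<..<x (Suc j)} \<Longrightarrow> deriv W y = poly (pderiv p) y"
      by (rule fe_space_deriv_eq_poly[OF W j]) blast
    define q where "q = (\<lambda>y. (A + B * y) * poly (pderiv p) y * poly p y + B / 2 * (poly p y)\<^sup>2)"
    define Q where "Q = (\<lambda>y. (A + B * y) * (poly p y)\<^sup>2 / 2)"
    \<comment> \<open>The end points of a cell form a null set, so \<open>f\<close> may be replaced
      by the smooth \<open>q\<close> whatever \<open>deriv W\<close> is there.\<close>
    have neg: "negligible {x j, x (Suc j)}" by simp
    have fq: "f y = q y" if "y \<in> {x j..x (Suc j)} - {x j, x (Suc j)}" for y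
      using that p[of y] p'[of y] by (auto simp: f_def q_def)
    have q: "q absolutely_integrable_on {x j..x (Suc j)}"
      unfolding q_def by (intro absolutely_integrable_continuous_real continuous_intros)
    show "f absolutely_integrable_on {x j..x (Suc j)}"
      by (rule absolutely_integrable_spike[OF q neg fq])
    have "(q has_integral Q (x (Suc j)) - Q (x j)) {x j..x (Suc j)}"
    proof (rule fundamental_theorem_of_calculus)
      show "x j \<le> x (Suc j)" using lt[OF j] by simp
      show "(Q has_vector_derivative q y) (at y within {x j..x (Suc j)})" for y
        unfolding Q_def q_def has_real_derivative_iff_has_vector_derivative[symmetric]
        by (auto intro!: derivative_eq_intros simp: power2_eq_square field_simps)
    qed
    from has_integral_spike[OF neg fq this]
    have "(f has_integral Q (x (Suc j)) - Q (x j)) {x j..x (Suc j)}" .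
    moreover have "Q (x j) = F (x j)" "Q (x (Suc j)) = F (x (Suc j))"
      using p lt[OF j] by (auto simp: F_def Q_def)
    ultimately show "(f has_integral F (x (Suc j)) - F (x j)) {x j..x (Suc j)}" by simp
  qed
  moreover have "x 0 = 0" "x N = 1" using mesh by (auto simp: is_mesh_def)
  \<comment> \<open>The boundary conditions on \<open>W\<close> remove both boundary terms.\<close>
  moreover have "F 0 = 0" "F 1 = 0" using W by (auto simp: F_def fe_space_def)
  ultimately have f01: "f absolutely_integrable_on {0..1}" "(f has_integral 0) {0..1}"
    by auto
  note f = LINT_Ioo_eq_has_integral[OF f01]
  have W2: "(\<lambda>y. (W y)\<^sup>2) absolutely_integrable_on {0<..<1}"
    by (intro absolutely_integrable_on_Ioo_if_continuous continuous_intros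
        fe_space_continuous_on[OF W])
  have "inner_L2 {0<..<1} (\<lambda>y. (A + B * y) * deriv W y) W
      = (LINT y:{0<..<1}|lebesgue. f y - B / 2 * (W y)\<^sup>2)"
    by (simp add: inner_L2_def f_def)
  also have "\<dots> = - (B / 2 * (LINT y:{0<..<1}|lebesgue. (W y)\<^sup>2))"
    using set_integral_diff(2)[OF f(1) set_integrable_mult_right[of "B / 2", OF W2]] f(2)
    by simp
  also have "\<dots> = - B / 2 * (norm_L2 {0<..<1} W)\<^sup>2"
    unfolding norm_L2_power2 inner_L2_def power2_eq_square[symmetric] by simp
  finally show ?thesis .
qed

lemma inner_L2_diff_quotient:
  assumes "continuous_on {a..b} v" and "continuous_on {a..b} w"
  shows "inner_L2 {a<..<b} (\<lambda>y. (v y - w y) / \<delta>) v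
    = ((norm_L2 {a<..<b} v)\<^sup>2 - inner_L2 {a<..<b} w v) / \<delta>"
proof -
  have v: "(\<lambda>y. v y * v y) absolutely_integrable_on {a<..<b}"
    and w: "(\<lambda>y. w y * v y) absolutely_integrable_on {a<..<b}"
    by (intro absolutely_integrable_on_Ioo_if_continuous continuous_intros assms)+
  have "inner_L2 {a<..<b} (\<lambda>y. (v y - w y) / \<delta>) v
      = (LINT y:{a<..<b}|lebesgue. (v y * v y - w y * v y) / \<delta>)"
    unfolding inner_L2_def by (simp add: algebra_simps)
  then show ?thesis
    unfolding norm_L2_power2 using set_integral_diff(2)[OF v w] by (simp add: inner_L2_def)
qed

section \<open>From one time step to all of them\<close>

text \<open>A source \<open>r l\<close> with \<open>1 \<le> l\<close> enters at step
  \<open>l\<close> and is multiplied by \<open>C\<close> in the steps \<open>l\<close> to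
  \<open>n\<close>, which gives the exponent \<open>n + 1 - l\<close>. The term for
  \<open>l = 0\<close> comes from no step; being non-negative, it is added in the base case.\<close>

lemma geometric_recursion_bound:
  fixes e r :: "nat \<Rightarrow> real" and C :: real
  assumes "0 \<le> C" and "\<And>l. 0 \<le> r l" and "\<And>n. n < m \<Longrightarrow> e (Suc n) \<le> C * (e n + r (Suc n))"
    and "n \<le> m"
  shows "e n \<le> C ^ n * e 0 + (\<Sum>l=0..n. C ^ (n + 1 - l) * r l)"
  using assms(4)
proof (induction n)
  case 0
  then show ?case using assms(1,2) by simp
next
  case (Suc n)
  \<comment> \<open>As \<open>l \<le> n\<close>, the natural subtraction does not truncate.\<close>
  have "C * (\<Sum>l=0..n. C ^ (n + 1 - l) * r l) = (\<Sum>l=0..n. C ^ (Suc n + 1 - l) * r l)"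
    unfolding sum_distrib_left by (rule sum.cong) (auto simp: Suc_diff_le)
  moreover have "e (Suc n) \<le> C * (C ^ n * e 0 + (\<Sum>l=0..n. C ^ (n + 1 - l) * r l) + r (Suc n))"
    using assms(1) Suc.IH Suc.prems
    by (intro order_trans[OF assms(3)] mult_left_mono add_mono) auto
  ultimately show ?case by (simp add: algebra_simps)
qed

text \<open>The factor on the left uses the bounds \<open>\<gamma>'max\<close> and
  \<open>\<gamma>0\<close> rather than the values at the current time, so one factor serves every
  step and component.\<close>

lemma backward_euler_step:
  fixes \<gamma>0 \<gamma>'max \<delta> :: real
  assumes adm: "admissible_data ne T \<alpha> \<beta> \<gamma>0 \<gamma>1 \<gamma>'max \<alpha>'max u0 f a ma Ma"
    and \<delta>: "0 < \<delta>" and T: "T = real ni * \<delta>"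
    and g: "in_L2 {0<..<1} (\<lambda>y. ref_source \<alpha> \<beta> (f i) y (real (Suc n) * \<delta>))"
    and mesh: "is_mesh x N h"
    and sol: "backward_euler_solution ne ni T \<delta> \<alpha> \<beta> u0 f a x N k V"
    and n: "n < ni" and i: "i \<in> {1..ne}"
  shows "(1 - \<delta> * (1 + \<gamma>'max / \<gamma>0)) * (norm_L2 {0<..<1} (V (Suc n) i))\<^sup>2
    \<le> (norm_L2 {0<..<1} (V n i))\<^sup>2
      + \<delta> * (norm_L2 {0<..<1} (\<lambda>y. ref_source \<alpha> \<beta> (f i) y (real (Suc n) * \<delta>)))\<^sup>2"
proof -
  define t where "t = real (Suc n) * \<delta>"
  define v where "v = V (Suc n) i"
  define w where "w = V n i"
  define G where "G = (\<lambda>y. ref_source \<alpha> \<beta> (f i) y t)"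
  define \<gamma> where "\<gamma> = \<beta> t - \<alpha> t"
  define \<gamma>' where "\<gamma>' = deriv_within {0..T} (\<lambda>\<tau>. \<beta> \<tau> - \<alpha> \<tau>) t"
  define s where "s = (\<lambda>j\<in>{1..ne}. nonlocal_term \<alpha> \<beta> t (V (Suc n) j))"
  define v2 w2 g2 where "v2 = (norm_L2 {0<..<1} v)\<^sup>2"
    and "w2 = (norm_L2 {0<..<1} w)\<^sup>2" and "g2 = (norm_L2 {0<..<1} G)\<^sup>2"
  have t: "t \<in> {0..T}" using n \<delta> unfolding t_def T by (simp add: mult_right_mono)
  have \<gamma>: "0 < \<gamma>0" "\<gamma>0 < \<gamma>" "\<bar>\<gamma>'\<bar> \<le> \<gamma>'max"
    using adm t unfolding admissible_data_def \<gamma>_def \<gamma>'_def by auto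
  have a: "0 \<le> a i s"
  proof -
    have "s \<in> {1..ne} \<rightarrow>\<^sub>E UNIV" unfolding s_def by auto
    then have "0 < ma" "ma \<le> a i s" using adm i unfolding admissible_data_def by blast+
    then show ?thesis by simp
  qed
  have v: "v \<in> fe_space x N k" using sol n i unfolding backward_euler_solution_def v_def by blast
  \<comment> \<open>For \<open>n = 0\<close> this is part of being an interpolant, for later steps
    part of being a solution.\<close>
  have w: "w \<in> fe_space x N k"
    using sol n i unfolding backward_euler_solution_def is_lagrange_interpolant_def w_def
    by (cases n) auto
  have sq: "set_integrable lebesgue {0<..<1} (\<lambda>y. (u y)\<^sup>2)" if "u \<in> fe_space x N k" for u
    by (intro absolutely_integrable_on_Ioo_if_continuous continuous_intros
        fe_space_continuous_on[OF that])
  have G: "set_integrable lebesgue {0<..<1} (\<lambda>y. (G y)\<^sup>2)"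
    using g unfolding in_L2_def G_def t_def by blast
  \<comment> \<open>The scheme with \<open>v\<close> as its own test function.\<close>
  have "inner_L2 {0<..<1} (\<lambda>y. (v y - w y) / \<delta>) v
      + coeff_b2 \<alpha> \<beta> t * a i s * inner_L2 {0<..<1} (deriv v) (deriv v)
      - inner_L2 {0<..<1} (\<lambda>y. coeff_b1 T \<alpha> \<beta> y t * deriv v y) v = inner_L2 {0<..<1} G v"
    using sol n i v
    unfolding backward_euler_solution_def Let_def v_def w_def t_def G_def s_def by blast
  moreover have "0 \<le> coeff_b2 \<alpha> \<beta> t * a i s * inner_L2 {0<..<1} (deriv v) (deriv v)"
    using a inner_L2_self_nonneg by (simp add: coeff_b2_def)
  \<comment> \<open>At fixed \<open>t\<close>, \<open>coeff_b1\<close> is \<open>A + B * y\<close>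
    with \<open>A = \<alpha>'(t) / \<gamma>\<close> and
    \<open>B = \<gamma>' / \<gamma>\<close>.\<close>
  moreover have "inner_L2 {0<..<1} (\<lambda>y. coeff_b1 T \<alpha> \<beta> y t * deriv v y) v = - (\<gamma>' / \<gamma>) / 2 * v2"
    using fe_space_convection_identity[OF mesh v, of "deriv_within {0..T} \<alpha> t / \<gamma>" "\<gamma>' / \<gamma>"]
    by (simp add: coeff_b1_def \<gamma>_def \<gamma>'_def v2_def add_divide_distrib)
  ultimately have "(v2 - inner_L2 {0<..<1} w v) / \<delta> + \<gamma>' / \<gamma> / 2 * v2 \<le> inner_L2 {0<..<1} G v"
    using inner_L2_diff_quotient[OF v[THEN fe_space_continuous_on] w[THEN fe_space_continuous_on],
        of \<delta>]
    by (simp add: v2_def)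
  moreover have "inner_L2 {0<..<1} G v \<le> (g2 + v2) / 2"
    unfolding g2_def v2_def by (rule inner_L2_le_half_norms[OF G sq[OF v]])
  ultimately have "(v2 - inner_L2 {0<..<1} w v) / \<delta> + \<gamma>' / \<gamma> / 2 * v2 \<le> (g2 + v2) / 2"
    by (rule order_trans)
  from mult_left_mono[OF this, of \<delta>] \<delta>
  have "v2 - inner_L2 {0<..<1} w v + \<delta> * (\<gamma>' / \<gamma>) * v2 / 2 \<le> \<delta> * (g2 + v2) / 2"
    by (simp add: distrib_left)
  \<comment> \<open>Half of \<open>v2\<close> is absorbed on the left; doubling the inequality then
    gives the factor \<open>1 + \<delta> * (\<gamma>' / \<gamma>) - \<delta>\<close>.\<close>
  moreover have "inner_L2 {0<..<1} w v \<le> (w2 + v2) / 2"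
    unfolding w2_def v2_def by (rule inner_L2_le_half_norms[OF sq[OF w] sq[OF v]])
  ultimately have "(1 + \<delta> * (\<gamma>' / \<gamma>) - \<delta>) * v2 \<le> w2 + \<delta> * g2"
    by (simp add: algebra_simps)
  \<comment> \<open>The worst case is a shrinking domain, with \<open>\<gamma>'\<close>
    negative.\<close>
  moreover have "(1 - \<delta> * (1 + \<gamma>'max / \<gamma>0)) * v2 \<le> (1 + \<delta> * (\<gamma>' / \<gamma>) - \<delta>) * v2"
  proof (rule mult_right_mono)
    have "- (\<gamma>' / \<gamma>) \<le> \<bar>\<gamma>'\<bar> / \<gamma>" using \<gamma> by (simp add: field_simps)
    also have "\<dots> \<le> \<gamma>'max / \<gamma>0" using \<gamma> by (intro frac_le) auto
    finally have "\<delta> * - (\<gamma>' / \<gamma>) \<le> \<delta> * (\<gamma>'max / \<gamma>0)"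
      using \<delta> by (intro mult_left_mono) auto
    then show "1 - \<delta> * (1 + \<gamma>'max / \<gamma>0) \<le> 1 + \<delta> * (\<gamma>' / \<gamma>) - \<delta>"
      by (simp add: algebra_simps)
  qed (simp add: v2_def)
  ultimately show ?thesis unfolding v2_def w2_def g2_def v_def w_def G_def t_def by simp
qed


text \<open>\<open>C\<close> is quantified before the data, the mesh, the degree and the number of
  steps, so it can depend on \<open>\<gamma>0\<close>, \<open>\<gamma>'max\<close> and
  \<open>\<delta>\<close> only.\<close>

theorem theorem7:
  fixes \<gamma>0 \<gamma>'max \<delta> :: real
  assumes "0 < \<gamma>0" and "0 < \<delta>" and "\<delta> < \<gamma>0 / (\<gamma>0 + \<gamma>'max)"
  shows "\<exists>C>0. \<forall>(ne::nat) (ni::nat) (T::real) (\<alpha>::real \<Rightarrow> real) (\<beta>::real \<Rightarrow> real)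
      (\<gamma>1::real) (\<alpha>'max::real) (u0::nat \<Rightarrow> real \<Rightarrow> real) (f::nat \<Rightarrow> real \<Rightarrow> real \<Rightarrow> real)
      (a::nat \<Rightarrow> (nat \<Rightarrow> real) \<Rightarrow> real) (ma::real) (Ma::real)
      (x::nat \<Rightarrow> real) (N::nat) (h::real) (k::nat) (V::nat \<Rightarrow> nat \<Rightarrow> real \<Rightarrow> real).
      admissible_data ne T \<alpha> \<beta> \<gamma>0 \<gamma>1 \<gamma>'max \<alpha>'max u0 f a ma Ma \<longrightarrow>
      T = real ni * \<delta> \<longrightarrow>
      (\<forall>n\<le>ni. \<forall>i\<in>{1..ne}. in_L2 {0<..<1} (\<lambda>y. ref_source \<alpha> \<beta> (f i) y (real n * \<delta>))) \<longrightarrow>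
      is_mesh x N h \<longrightarrow>
      1 \<le> k \<longrightarrow>
      backward_euler_solution ne ni T \<delta> \<alpha> \<beta> u0 f a x N k V \<longrightarrow>
      (\<forall>n<ni. \<forall>i\<in>{1..ne}.
         (norm_L2 {0<..<1} (V (n + 1) i))\<^sup>2 \<le>
           C ^ (n + 1) * (norm_L2 {0<..<1} (V 0 i))\<^sup>2
           + (\<Sum>l=0..n+1. C ^ (n + 2 - l) * \<delta> *
               (norm_L2 {0<..<1} (\<lambda>y. ref_source \<alpha> \<beta> (f i) y (real l * \<delta>)))\<^sup>2))"
proof -
  define c where "c = 1 - \<delta> * (1 + \<gamma>'max / \<gamma>0)"
  \<comment> \<open>The sign of \<open>\<gamma>'max\<close> is not assumed; the positive
    \<open>\<delta>\<close> lies below the quotient, which forces a positive denominator.\<close>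
  have "0 < \<gamma>0 + \<gamma>'max"
    using assms by (smt (verit) zero_less_divide_iff)
  with assms have "\<delta> * (\<gamma>0 + \<gamma>'max) < \<gamma>0" by (simp add: pos_less_divide_eq)
  with assms(1) have c: "0 < c" unfolding c_def by (simp add: field_simps)
  show ?thesis
  \<comment> \<open>Dividing the one-step estimate by \<open>c\<close> suggests the witness
    \<open>1 / c\<close>.\<close>
  proof (intro exI[of _ "1 / c"] conjI allI impI ballI)
    show "0 < 1 / c" using c by simp
  next
    fix ne ni T \<alpha> \<beta> \<gamma>1 \<alpha>'max u0 f a ma Ma x N h k V n i
    assume adm: "admissible_data ne T \<alpha> \<beta> \<gamma>0 \<gamma>1 \<gamma>'max \<alpha>'max u0 f a ma Ma"
      and T: "T = real ni * \<delta>"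
      and g: "\<forall>n\<le>ni. \<forall>i\<in>{1..ne}. in_L2 {0<..<1} (\<lambda>y. ref_source \<alpha> \<beta> (f i) y (real n * \<delta>))"
      and mesh: "is_mesh x N h"
      and sol: "backward_euler_solution ne ni T \<delta> \<alpha> \<beta> u0 f a x N k V"
      and n: "n < ni" and i: "i \<in> {1..ne}"
    define e where "e = (\<lambda>m. (norm_L2 {0<..<1} (V m i))\<^sup>2)"
    define r where "r = (\<lambda>l::nat. \<delta> *
      (norm_L2 {0<..<1} (\<lambda>y. ref_source \<alpha> \<beta> (f i) y (real l * \<delta>)))\<^sup>2)"
    have "e (Suc m) \<le> 1 / c * (e m + r (Suc m))" if m: "m < ni" for m
    proof -
      have "in_L2 {0<..<1} (\<lambda>y. ref_source \<alpha> \<beta> (f i) y (real (Suc m) * \<delta>))"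
        using g i m by (meson Suc_leI)
      from backward_euler_step[OF adm assms(2) T this mesh sol m i]
      have "c * e (Suc m) \<le> e m + r (Suc m)" unfolding c_def e_def r_def .
      then show ?thesis using c by (simp add: field_simps)
    qed
    \<comment> \<open>At index \<open>n + 1\<close> the exponent \<open>(n + 1) + 1 - l\<close> is
      the required \<open>n + 2 - l\<close>.\<close>
    from geometric_recursion_bound[of "1 / c" r ni e "n + 1", OF _ _ this] c assms(2) n
    show "(norm_L2 {0<..<1} (V (n + 1) i))\<^sup>2 \<le>
        (1 / c) ^ (n + 1) * (norm_L2 {0<..<1} (V 0 i))\<^sup>2
        + (\<Sum>l=0..n+1. (1 / c) ^ (n + 2 - l) * \<delta> *
            (norm_L2 {0<..<1} (\<lambda>y. ref_source \<alpha> \<beta> (f i) y (real l * \<delta>)))\<^sup>2)"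
      by (simp add: e_def r_def mult.assoc)
  qed
qed

end
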